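(* Let $\mathcal{I}$ be an index coding (IC) problem over a finite field $\mathbb{F}_q$ with $L\times K$ fitting matrix $F_X$ and an $r\times K$ index code $G$. Let $D$ be an $L\times r$ matrix over $\mathbb{F}_q$ such that $DG\approx F_X$ (such a $D$ exists because $G$ is an index code). Let $C$ be an $r\times r$ involutory matrix over $\mathbb{F}_q$ (i.e. $C^2=I$), and let $B_X^X$ be an $L\times K$ $X$-fitting matrix such that $DCG\approx B_X^X$. Then the $2$-order extended IC problem $\mathcal{I}_{ext}$ with fitting matrix $$\begin{pmatrix}F_X & B_X^X\\ B_X^X & F_X\end{pmatrix}$$ has the index code $(G~~CG)$ (an $r\times 2K$ matrix). Furthermore, if $G$ is optimal for $\mathcal{I}$, then $(G~~CG)$ is optimal for $\mathcal{I}_{ext}$, and hence $\mathcal{I}_{ext}$ is a rank-invariant extension of $\mathcal{I}$.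
   Context: Fix a finite field $\mathbb{F}_q$. A fitting matrix $F_X$ of size $L\times K$ ($L\ge K$) is a matrix with entries in the symbol set $\{0,1,X\}$ such that each row contains exactly one $1$ (its other entries being $0$s and $X$s), and for every column $k$ there is at least one row having its $1$ in position $k$. It defines an IC problem with $K$ messages, with symbols $x_1,\dots,x_K\in\mathbb{F}_q$, and $L$ receivers, one per row: the receiver of a row demands the message $k$ where the row has its $1$, and has as side-information exactly the message symbols at the positions where the row has an $X$. A (scalar linear) index code of length $r$ for the problem is an $r\times K$ matrix $G$ over $\mathbb{F}_q$ such that, when $G\boldsymbol{x}$ is broadcast for $\boldsymbol{x}=(x_1,\dots,x_K)^T\in\mathbb{F}_q^K$, every receiver can recover its demanded symbol from $G\boldsymbol{x}$ and its side-information symbols (for all $\boldsymbol{x}$). The code is optimal if its length $r$ is the minimum possible among all such codes for the problem. An $X$-fitting matrix $B_X^X$ is a matrix with all entries in $\{0,X\}$. For a matrix $F$ over $\mathbb{F}_q$: $F\approx F_X$ (for a fitting matrix $F_X$ of the same size) means that $F$ has entry $0$ wherever $F_X$ has $0$ and entry $1$ wherever $F_X$ has $1$ (entries at $X$ positions being arbitrary); $F\approx B_X^X$ (for an $X$-fitting matrix of the same size) means that $F$ has entry $0$ wherever $B_X^X$ has $0$. $minrk(F_X)$ is the minimum rank over $\mathbb{F}_q$ of the matrices $F$ over $\mathbb{F}_q$ obtained from $F_X$ by replacing each $X$ by an arbitrary element of $\mathbb{F}_q$ (independently for each position). It is a known fact that the optimal length of a scalar linear index code equals $minrk(F_X)$.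 An IC problem $\mathcal{I}_{ext}$ with fitting matrix $F_{ext,X}$ is an extension of $\mathcal{I}$ (with $L\times K$ fitting matrix $F_X$) if $F_X$ is a submatrix of $F_{ext,X}$; it is a $2$-order extension if $F_{ext,X}$ is $2L\times 2K$. The extension is rank-invariant if the optimal code lengths are equal, i.e. $minrk(F_{ext,X})=minrk(F_X)$. *)

theory Defs
  imports
    "Jordan_Normal_Form.Matrix"
    "Jordan_Normal_Form.DL_Rank"
    "Jordan_Normal_Form.DL_Submatrix"
begin

datatype symbol = Sym0 | Sym1 | SymX

definition fitting_matrix :: "symbol mat \<Rightarrow> bool" where
  "fitting_matrix FX \<longleftrightarrow>
     dim_col FX \<le> dim_row FX \<and>
     (\<forall>i < dim_row FX. \<exists>!k. k < dim_col FX \<and> FX $$ (i, k) = Sym1) \<and>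
     (\<forall>k < dim_col FX. \<exists>i < dim_row FX. FX $$ (i, k) = Sym1)"

definition X_fitting_matrix :: "symbol mat \<Rightarrow> bool" where
  "X_fitting_matrix BX \<longleftrightarrow>
     (\<forall>i < dim_row BX. \<forall>j < dim_col BX. BX $$ (i, j) \<in> {Sym0, SymX})"

text \<open>The IC problem of a fitting matrix: receiver \<open>i\<close> demands message \<open>demand FX i\<close> and knows the
  messages in \<open>side_info FX i\<close>.\<close>

definition demand :: "symbol mat \<Rightarrow> nat \<Rightarrow> nat" where
  "demand FX i = (THE k. k < dim_col FX \<and> FX $$ (i, k) = Sym1)"

definition side_info :: "symbol mat \<Rightarrow> nat \<Rightarrow> nat set" where
  "side_info FX i = {j. j < dim_col FX \<and> FX $$ (i, j) = SymX}"

text \<open>A receiver sees the broadcast vector and the restriction of the message vector to its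
  side-information. Decoding functions may be arbitrary, not necessarily linear.\<close>

definition index_code :: "symbol mat \<Rightarrow> 'q::{field,finite} mat \<Rightarrow> bool" where
  "index_code FX G \<longleftrightarrow>
     dim_col G = dim_col FX \<and>
     (\<forall>i < dim_row FX. \<exists>decode :: 'q vec \<Rightarrow> (nat \<rightharpoonup> 'q) \<Rightarrow> 'q.
        \<forall>x \<in> carrier_vec (dim_col FX).
          decode (G *\<^sub>v x) ((\<lambda>j. Some (x $ j)) |` side_info FX i) = x $ demand FX i)"

definition optimal_index_code :: "symbol mat \<Rightarrow> 'q::{field,finite} mat \<Rightarrow> bool" where
  "optimal_index_code FX G \<longleftrightarrow>
     index_code FX G \<and> (\<forall>G' :: 'q mat. index_code FX G' \<longrightarrow> dim_row G \<le> dim_row G')"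

definition optimal_length :: "'q::{field,finite} itself \<Rightarrow> symbol mat \<Rightarrow> nat" where
  "optimal_length _ FX = (LEAST r. \<exists>G :: 'q mat. dim_row G = r \<and> index_code FX G)"

text \<open>One relation serves for both kinds of symbol matrices, since an X-fitting matrix
  has no entry \<open>Sym1\<close>.\<close>

definition fits :: "'q::{field,finite} mat \<Rightarrow> symbol mat \<Rightarrow> bool" (infix \<open>\<approx>\<^sub>X\<close> 50) where
  "F \<approx>\<^sub>X FX \<longleftrightarrow>
     F \<in> carrier_mat (dim_row FX) (dim_col FX) \<and>
     (\<forall>i < dim_row FX. \<forall>j < dim_col FX.
        (FX $$ (i, j) = Sym0 \<longrightarrow> F $$ (i, j) = 0) \<and>
        (FX $$ (i, j) = Sym1 \<longrightarrow> F $$ (i, j) = 1))"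

definition minrk :: "'q::{field,finite} itself \<Rightarrow> symbol mat \<Rightarrow> nat" where
  "minrk _ FX = (LEAST s. \<exists>F :: 'q mat. F \<approx>\<^sub>X FX \<and> vec_space.rank (dim_row F) F = s)"

definition extension :: "symbol mat \<Rightarrow> symbol mat \<Rightarrow> bool" where
  "extension FX FX_ext \<longleftrightarrow>
     fitting_matrix FX \<and> fitting_matrix FX_ext \<and> (\<exists>I J. FX = submatrix FX_ext I J)"

definition second_order_extension :: "symbol mat \<Rightarrow> symbol mat \<Rightarrow> bool" where
  "second_order_extension FX FX_ext \<longleftrightarrow>
     extension FX FX_ext \<and> FX_ext \<in> carrier_mat (2 * dim_row FX) (2 * dim_col FX)"

definition rank_invariant_extension ::
    "'q::{field,finite} itself \<Rightarrow> symbol mat \<Rightarrow> symbol mat \<Rightarrow> bool" where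
  "rank_invariant_extension q FX FX_ext \<longleftrightarrow>
     extension FX FX_ext \<and> optimal_length q FX_ext = optimal_length q FX"

definition involutory :: "'q::{field,finite} mat \<Rightarrow> bool" where
  "involutory C \<longleftrightarrow> square_mat C \<and> C * C = 1\<^sub>m (dim_row C)"

definition append_cols :: "'a::zero mat \<Rightarrow> 'a mat \<Rightarrow> 'a mat" (infixr \<open>@\<^sub>c\<close> 65) where
  "A @\<^sub>c B = four_block_mat A B (0\<^sub>m 0 (dim_col A)) (0\<^sub>m 0 (dim_col B))"

end

theory Submission
  imports Defs
begin

text \<open>A matrix \<open>G\<close> is an index code for \<open>FX\<close> exactly when some decoding matrix \<open>D\<close> satisfies
  \<open>D * G \<approx>\<^sub>X FX\<close>. If \<open>C * C = 1\<close>, stacking \<open>D\<close> on \<open>D * C\<close> decodes the code \<open>(G, C * G)\<close>: the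
  diagonal blocks of the product are both \<open>D * G\<close> and the off-diagonal blocks are both \<open>D * C * G\<close>.
  Optimality carries over because the first \<open>K\<close> columns of a code for the extension form a code
  for \<open>FX\<close>. That \<open>minrk\<close> is the optimal length follows from rank factorizations \<open>F = D * G\<close>.\<close>

section \<open>Linear functionals and rank factorizations\<close>

text \<open>Induction on \<open>r\<close>: on the kernel of the last functional, itself closed under
  both operations, the induction hypothesis gives coefficients. One vector off that kernel then
  determines the last coefficient. The set \<open>W\<close> and its operations are parameters
  because vectors of a fixed dimension form a carrier set and not a type.\<close>

lemma functional_in_span_of_common_kernel:
  fixes f :: "nat \<Rightarrow> 'v \<Rightarrow> 'q::field" and add :: "'v \<Rightarrow> 'v \<Rightarrow> 'v" and scale :: "'q \<Rightarrow> 'v \<Rightarrow> 'v"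
  assumes "\<And>x y. x \<in> W \<Longrightarrow> y \<in> W \<Longrightarrow> add x y \<in> W"
    and "\<And>a x. x \<in> W \<Longrightarrow> scale a x \<in> W"
    and "\<And>i x y. i < r \<Longrightarrow> x \<in> W \<Longrightarrow> y \<in> W \<Longrightarrow> f i (add x y) = f i x + f i y"
    and "\<And>i a x. i < r \<Longrightarrow> x \<in> W \<Longrightarrow> f i (scale a x) = a * f i x"
    and "\<And>x y. x \<in> W \<Longrightarrow> y \<in> W \<Longrightarrow> g (add x y) = g x + g y"
    and "\<And>a x. x \<in> W \<Longrightarrow> g (scale a x) = a * g x"
    and "\<And>x. x \<in> W \<Longrightarrow> (\<And>i. i < r \<Longrightarrow> f i x = 0) \<Longrightarrow> g x = 0"
  shows "\<exists>c. \<forall>x \<in> W. g x = (\<Sum>i<r. c i * f i x)"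
  using assms
proof (induction r arbitrary: W)
  case 0
  then show ?case by auto
next
  case (Suc r)
  note add_W = Suc.prems(1) and scale_W = Suc.prems(2) and f_add = Suc.prems(3)
    and f_scale = Suc.prems(4) and g_add = Suc.prems(5) and g_scale = Suc.prems(6)
    and kernel = Suc.prems(7)
  define W' where "W' = {x \<in> W. f r x = 0}"
  have "\<exists>c. \<forall>x \<in> W'. g x = (\<Sum>i<r. c i * f i x)"
  proof (rule Suc.IH)
    fix x assume x: "x \<in> W'" and z: "\<And>i. i < r \<Longrightarrow> f i x = 0"
    have "f i x = 0" if "i < Suc r" for i
      using that x z by (cases "i = r") (auto simp: W'_def)
    then show "g x = 0"
      using x kernel by (auto simp: W'_def)
  qed (auto simp: W'_def add_W scale_W f_add f_scale g_add g_scale)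
  then obtain c where c: "\<And>x. x \<in> W' \<Longrightarrow> g x = (\<Sum>i<r. c i * f i x)"
    by blast
  show ?case
  proof (cases "\<exists>w \<in> W. f r w \<noteq> 0")
    case False
    then have "W' = W" by (auto simp: W'_def)
    with False c have "\<forall>x \<in> W. g x = (\<Sum>i<Suc r. c i * f i x)" by auto
    then show ?thesis by blast
  next
    case True
    then obtain w where w: "w \<in> W" "f r w \<noteq> 0" by blast
    \<comment> \<open>This is the value of the last coefficient for which the extended combination
      agrees with \<open>g\<close> at \<open>w\<close>.\<close>
    define b where "b = (g w - (\<Sum>i<r. c i * f i w)) / f r w"
    have "g x = (\<Sum>i<Suc r. (c(r := b)) i * f i x)" if x: "x \<in> W" for x
    proof -
      \<comment> \<open>Moving \<open>x\<close> by \<open>t\<close> times \<open>w\<close> lands in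
        the kernel \<open>W'\<close> of the last functional, where \<open>c\<close> already
        represents \<open>g\<close>.\<close>
      define t where "t = - f r x / f r w"
      define y where "y = add x (scale t w)"
      have tw: "scale t w \<in> W" using scale_W w by blast
      have y: "y \<in> W" using add_W x tw by (simp add: y_def)
      have fy: "f i y = f i x + t * f i w" if "i < Suc r" for i
        using f_add[OF that x tw] f_scale[OF that w(1)] by (simp add: y_def)
      have gy: "g y = g x + t * g w"
        using g_add[OF x tw] g_scale[OF w(1)] by (simp add: y_def)
      have "f r y = 0" using fy[of r] w by (simp add: t_def)
      with y have "y \<in> W'" by (simp add: W'_def)
      from c[OF this] have "g x + t * g w = (\<Sum>i<r. c i * f i x) + t * (\<Sum>i<r. c i * f i w)"
        by (simp add: gy fy sum.distrib sum_distrib_left algebra_simps)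
      then have "g x = (\<Sum>i<r. c i * f i x) - t * (g w - (\<Sum>i<r. c i * f i w))"
        by (simp add: algebra_simps)
      also have "- t * (g w - (\<Sum>i<r. c i * f i w)) = b * f r x"
        using w by (simp add: t_def b_def)
      then have "(\<Sum>i<r. c i * f i x) - t * (g w - (\<Sum>i<r. c i * f i w))
          = (\<Sum>i<r. c i * f i x) + b * f r x"
        by simp
      finally show ?thesis by simp
    qed
    then show ?thesis by blast
  qed
qed

section \<open>Column bases and rank factorizations\<close>

text \<open>The coefficients that express column \<open>j\<close> of \<open>A\<close> through the
  columns of \<open>B\<close> are taken as column \<open>j\<close> of \<open>X\<close>.\<close>

lemma (in vec_space) mat_factor_if_cols_in_span:
  assumes A: "A \<in> carrier_mat n nc" and B: "B \<in> carrier_mat n s"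
    and sub: "set (cols A) \<subseteq> span (set (cols B))"
  shows "\<exists>X \<in> carrier_mat s nc. A = B * X"
proof -
  have "\<exists>x \<in> carrier_vec s. B *\<^sub>v x = col A j" if "j < nc" for j
  proof -
    have "col A j \<in> col_space B"
      using that A sub unfolding col_space_def cols_def by auto
    then show ?thesis
      using B unfolding col_space_eq[OF B] by auto
  qed
  then obtain x where x: "\<And>j. j < nc \<Longrightarrow> x j \<in> carrier_vec s"
      "\<And>j. j < nc \<Longrightarrow> B *\<^sub>v x j = col A j"
    by metis
  define X where "X = mat_of_cols s (map x [0..<nc])"
  have "A = B * X"
  proof (rule mat_col_eqI)
    fix j assume "j < dim_col (B * X)"
    then have j: "j < nc" by (simp add: X_def)
    then have "col (B * X) j = B *\<^sub>v col X j"
      using B by (intro col_mult2[of _ n s _ nc]) (auto simp: X_def)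
    also have "col X j = x j" using j x by (simp add: X_def)
    finally show "col A j = col (B * X) j" using x j by simp
  qed (use A B in \<open>auto simp: X_def\<close>)
  moreover have "X \<in> carrier_mat s nc" by (simp add: X_def carrier_matI)
  ultimately show ?thesis by blast
qed

text \<open>A maximal independent set of columns spans every column, since a column outside its span
  could be added. It is the column basis behind both rank lemmas below.\<close>

lemma (in vec_space) maximal_lin_indpt_cols:
  assumes "A \<in> carrier_mat n nc"
  obtains S where "finite S" "S \<subseteq> set (cols A)" "lin_indpt S" "rank A = card S"
    "set (cols A) \<subseteq> span S"
proof -
  let ?P = "\<lambda>T. T \<subseteq> set (cols A) \<and> lin_indpt T"
  have carr: "set (cols A) \<subseteq> carrier_vec n"
    using assms cols_dim by blast
  have "?P {}" by (simp add: finite_lin_indpt2)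
  then obtain S where S: "maximal S ?P" "finite S"
    using maximal_exists_superset[of "set (cols A)" ?P "{}"] by auto
  then have PS: "?P S" by (simp add: maximal_def)
  have S_carr: "S \<subseteq> carrier_vec n" using PS carr by blast
  have "v \<in> span S" if v: "v \<in> set (cols A)" for v
  proof (rule ccontr)
    assume nv: "v \<notin> span S"
    have "v \<notin> S" using nv span_mem[OF S_carr] by blast
    moreover have "lin_indpt (S \<union> {v})"
      using lin_dep_iff_in_span[of S v] S_carr PS v carr nv calculation by auto
    ultimately show False
      using S(1) PS v unfolding maximal_def by blast
  qed
  then show ?thesis
    using that[of S] S PS rank_card_indpt[OF assms S(1)] by blast
qed

text \<open>The left factor lists a column basis of \<open>A\<close>. This is what turns a matrix of
  small rank into a short code.\<close>

lemma (in vec_space) rank_factorization: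
  assumes A: "A \<in> carrier_mat n nc"
  shows "\<exists>B \<in> carrier_mat n (rank A). \<exists>X \<in> carrier_mat (rank A) nc. A = B * X"
proof -
  obtain S where S: "finite S" "S \<subseteq> set (cols A)" "lin_indpt S" "rank A = card S"
      "set (cols A) \<subseteq> span S"
    using maximal_lin_indpt_cols[OF A] .
  \<comment> \<open>Distinctness makes the number of listed columns equal to \<open>card S\<close>,
    the rank.\<close>
  obtain ss where ss: "set ss = S" "distinct ss"
    using finite_distinct_list[OF S(1)] by blast
  have carr: "set ss \<subseteq> carrier_vec n"
    using S ss A cols_dim by blast
  have B: "mat_of_cols n ss \<in> carrier_mat n (rank A)"
    using S ss distinct_card[of ss] by (auto simp: carrier_matI)
  show ?thesis
    using mat_factor_if_cols_in_span[OF A B] B S ss carr by (auto simp: cols_mat_of_cols)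
qed

text \<open>Every column of the product lies in the span of the at most \<open>r\<close> columns of
  \<open>B\<close>, so the exchange lemma bounds the size of an independent set of them.\<close>

lemma (in vec_space) rank_mult_le_inner_dim:
  assumes B: "B \<in> carrier_mat n r" and X: "X \<in> carrier_mat r nc"
  shows "rank (B * X) \<le> r"
proof -
  have BX: "B * X \<in> carrier_mat n nc" using B X by auto
  obtain S where S: "finite S" "S \<subseteq> set (cols (B * X))" "lin_indpt S" "rank (B * X) = card S"
    using maximal_lin_indpt_cols[OF BX] .
  have carr: "set (cols B) \<subseteq> carrier_vec n" using B cols_dim by blast
  have "S \<subseteq> span (set (cols B))"
  proof
    fix v assume "v \<in> S"
    then have "v \<in> set (cols (B * X))" using S by blast
    then obtain j where j: "j < nc" "v = col (B * X) j"
      using X by (auto simp: cols_def)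
    then have "v = B *\<^sub>v col X j" using col_mult2[OF B X] by simp
    moreover have "col X j \<in> carrier_vec (dim_col B)" using B X by (auto simp: carrier_vecI)
    moreover have "B *\<^sub>v col X j \<in> carrier_vec (dim_row B)" by (auto simp: carrier_vecI)
    ultimately have "v \<in> col_space B"
      unfolding col_space_eq[OF B] by blast
    then show "v \<in> span (set (cols B))" by (simp add: col_space_def)
  qed
  \<comment> \<open>The exchange lemma \<open>replacement\<close> bounds a cardinality by an integer
    difference. That difference is therefore nonnegative, which is all that is used.\<close>
  then have "\<exists>C :: 'a vec set. int (card C) \<le> int (card (set (cols B))) - int (card S)"
    using replacement[of S "set (cols B)"] S(1,3) carr by auto
  then have "card S \<le> card (set (cols B))" by linarith
  also have "\<dots> \<le> r" using card_length[of "cols B"] B by simp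
  finally show ?thesis using S by simp
qed

section \<open>Decoding matrices\<close>

lemma fitting_matrix_demand:
  assumes "fitting_matrix FX" "i < dim_row FX"
  shows "demand FX i < dim_col FX" "FX $$ (i, demand FX i) = Sym1"
    and "\<And>k. k < dim_col FX \<Longrightarrow> FX $$ (i, k) = Sym1 \<Longrightarrow> k = demand FX i"
proof -
  have ex1: "\<exists>!k. k < dim_col FX \<and> FX $$ (i, k) = Sym1"
    using assms by (auto simp: fitting_matrix_def)
  from theI'[OF ex1] show "demand FX i < dim_col FX" "FX $$ (i, demand FX i) = Sym1"
    by (auto simp: demand_def)
  with ex1 show "\<And>k. k < dim_col FX \<Longrightarrow> FX $$ (i, k) = Sym1 \<Longrightarrow> k = demand FX i"
    by blast
qed

text \<open>Row \<open>i\<close> of \<open>D\<close> applied to the broadcast is row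
  \<open>i\<close> of \<open>D * G\<close> applied to the message. That row is 1 at the demand and 0
  at all other positions outside the side-information, so subtracting the known terms leaves the
  demanded symbol.\<close>

lemma index_code_if_decoding_matrix:
  fixes G :: "'q::{field,finite} mat"
  assumes FX: "fitting_matrix FX" and D: "D \<in> carrier_mat (dim_row FX) (dim_row G)"
    and fits: "D * G \<approx>\<^sub>X FX"
  shows "index_code FX G"
  unfolding index_code_def
proof (intro conjI allI impI)
  show dim_G: "dim_col G = dim_col FX"
    using fits by (auto simp: fits_def)
  fix i assume i: "i < dim_row FX"
  let ?d = "demand FX i" and ?S = "side_info FX i" and ?K = "dim_col FX"
  note d = fitting_matrix_demand[OF FX i]
  \<comment> \<open>The sum runs over the side-information only, so \<open>the\<close> is evaluated
    just where the receiver's map is defined.\<close>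
  define decode :: "'q vec \<Rightarrow> (nat \<rightharpoonup> 'q) \<Rightarrow> 'q" where
    "decode y s = row D i \<bullet> y - (\<Sum>j \<in> ?S. (D * G) $$ (i, j) * the (s j))" for y s
  have "decode (G *\<^sub>v x) ((\<lambda>j. Some (x $ j)) |` ?S) = x $ ?d" if x: "x \<in> carrier_vec ?K" for x
  proof -
    have "row D i \<bullet> (G *\<^sub>v x) = (D *\<^sub>v (G *\<^sub>v x)) $ i"
      using D i by simp
    also have "\<dots> = ((D * G) *\<^sub>v x) $ i"
      using assoc_mult_mat_vec[OF D, of G ?K x] x dim_G by (metis carrier_matI)
    also have "\<dots> = (\<Sum>j<?K. (D * G) $$ (i, j) * x $ j)"
      using D i x dim_G by (auto simp: scalar_prod_def atLeast0LessThan intro!: sum.cong)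
    also have "\<dots> = (\<Sum>j \<in> insert ?d ?S. (D * G) $$ (i, j) * x $ j)"
    proof (rule sum.mono_neutral_right)
      show "insert ?d ?S \<subseteq> {..<?K}"
        using d(1) by (auto simp: side_info_def)
      show "\<forall>j \<in> {..<?K} - insert ?d ?S. (D * G) $$ (i, j) * x $ j = 0"
      proof
        fix j assume j: "j \<in> {..<?K} - insert ?d ?S"
        \<comment> \<open>A position that is neither demanded nor known carries no
          \<open>SymX\<close>, and no \<open>Sym1\<close> because the 1 of a row is unique.\<close>
        then have "FX $$ (i, j) = Sym0"
          using d(3)[of j] by (cases "FX $$ (i, j)") (auto simp: side_info_def)
        then show "(D * G) $$ (i, j) * x $ j = 0"
          using fits i j by (auto simp: fits_def)
      qed
    qed auto
    also have "\<dots> = (D * G) $$ (i, ?d) * x $ ?d + (\<Sum>j \<in> ?S. (D * G) $$ (i, j) * x $ j)"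
      using d(2) by (subst sum.insert) (auto simp: side_info_def)
    also have "(D * G) $$ (i, ?d) = 1"
      using fits i d(1,2) by (auto simp: fits_def)
    finally show ?thesis
      by (simp add: decode_def)
  qed
  then show "\<exists>decode. \<forall>x \<in> carrier_vec ?K.
      decode (G *\<^sub>v x) ((\<lambda>j. Some (x $ j)) |` ?S) = x $ ?d"
    by blast
qed

text \<open>A message vector that vanishes on the side-information and has broadcast \<open>0\<close> looks to the
  receiver like the zero vector, so its demanded entry is \<open>0\<close>: the demanded coordinate vanishes on
  the common kernel of the rows of \<open>G\<close>, hence is a combination of them there.\<close>

lemma decoding_matrix_if_index_code:
  fixes G :: "'q::{field,finite} mat"
  assumes FX: "fitting_matrix FX" and code: "index_code FX G"
  shows "\<exists>D \<in> carrier_mat (dim_row FX) (dim_row G). D * G \<approx>\<^sub>X FX"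
proof -
  let ?K = "dim_col FX" and ?r = "dim_row G"
  have dim_G: "dim_col G = ?K"
    using code by (simp add: index_code_def)
  then have G: "G \<in> carrier_mat ?r ?K"
    by (intro carrier_matI) simp_all
  define W :: "nat \<Rightarrow> 'q vec set" where
    "W i = {x \<in> carrier_vec ?K. \<forall>j \<in> side_info FX i. x $ j = 0}" for i
  have "\<exists>c. \<forall>x \<in> W i. x $ demand FX i = (\<Sum>k<?r. c k * (G *\<^sub>v x) $ k)"
    if i: "i < dim_row FX" for i
  proof -
    have d: "demand FX i < ?K"
      by (rule fitting_matrix_demand(1)[OF FX i])
    obtain decode where dec: "\<And>x. x \<in> carrier_vec ?K \<Longrightarrow>
        decode (G *\<^sub>v x) ((\<lambda>j. Some (x $ j)) |` side_info FX i) = x $ demand FX i"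
      using code i unfolding index_code_def by blast
    have carr: "x \<in> carrier_vec ?K" if "x \<in> W i" for x
      using that by (simp add: W_def)
    have kernel: "x $ demand FX i = 0"
      if x: "x \<in> W i" and z: "\<And>k. k < ?r \<Longrightarrow> (G *\<^sub>v x) $ k = 0" for x
    proof -
      have "G *\<^sub>v x = 0\<^sub>v ?r"
        using z by (intro eq_vecI) (simp_all del: index_mult_mat_vec)
      also have "\<dots> = G *\<^sub>v 0\<^sub>v ?K"
        by (intro eq_vecI) (simp_all add: scalar_prod_def dim_G)
      finally have "G *\<^sub>v x = G *\<^sub>v 0\<^sub>v ?K" .
      moreover have "(\<lambda>j. Some (x $ j)) |` side_info FX i
          = (\<lambda>j. Some (0\<^sub>v ?K $ j)) |` side_info FX i"
        using x by (auto simp: W_def restrict_map_def side_info_def)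
      ultimately have "x $ demand FX i = 0\<^sub>v ?K $ demand FX i"
        using dec[of x] dec[of "0\<^sub>v ?K"] carr[OF x] by simp
      then show ?thesis using d by simp
    qed
    show ?thesis
    proof (rule functional_in_span_of_common_kernel[where W = "W i" and add = "(+)"
        and scale = "(\<cdot>\<^sub>v)" and f = "\<lambda>k x. (G *\<^sub>v x) $ k" and g = "\<lambda>x. x $ demand FX i"],
        goal_cases)
      case 1
      then show ?case by (auto simp: W_def side_info_def)
    next
      case 2
      then show ?case by (auto simp: W_def side_info_def)
    next
      case (3 k x y)
      then show ?case
        using mult_add_distrib_mat_vec[OF G, of x y] carr[of x] carr[of y]
        by (simp del: index_mult_mat_vec)
    next
      case (4 k a x)
      then show ?case
        using mult_mat_vec[OF G, of x a] carr[of x] by (simp del: index_mult_mat_vec)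
    next
      case (5 x y)
      then show ?case using carr[of x] carr[of y] d by simp
    next
      case (6 a x)
      then show ?case using carr[of x] d by simp
    next
      case (7 x)
      then show ?case using kernel by blast
    qed
  qed
  then obtain c where c: "\<And>i x. i < dim_row FX \<Longrightarrow> x \<in> W i \<Longrightarrow>
      x $ demand FX i = (\<Sum>k<?r. c i k * (G *\<^sub>v x) $ k)"
    by metis
  define D where "D = mat (dim_row FX) ?r (\<lambda>(i, k). c i k)"
  have D: "D \<in> carrier_mat (dim_row FX) ?r"
    by (simp add: D_def)
  have DG: "(D * G) $$ (i, j) = (if j = demand FX i then 1 else 0)"
    if i: "i < dim_row FX" and j: "j < ?K" and ns: "j \<notin> side_info FX i" for i j
  proof -
    \<comment> \<open>Testing the representation on a unit vector reads off one entry of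
      \<open>D * G\<close>. This works only outside the side-information, but inside it
      \<open>FX\<close> has \<open>SymX\<close> and asks for nothing.\<close>
    have "unit_vec ?K j \<in> W i"
      using j ns by (auto simp: W_def side_info_def unit_vec_def)
    from c[OF i this] have "unit_vec ?K j $ demand FX i = (\<Sum>k<?r. c i k * G $$ (k, j))"
      using dim_G j by simp
    also have "\<dots> = (D * G) $$ (i, j)"
      using dim_G i j by (auto simp: D_def scalar_prod_def atLeast0LessThan)
    finally show ?thesis
      using fitting_matrix_demand(1)[OF FX i] j by (auto simp: unit_vec_def)
  qed
  have "D * G \<approx>\<^sub>X FX"
    unfolding fits_def
  proof (intro conjI allI impI)
    show "D * G \<in> carrier_mat (dim_row FX) ?K"
      by (intro carrier_matI) (simp_all add: D_def dim_G)
    fix i j assume ij: "i < dim_row FX" "j < ?K"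
    note d = fitting_matrix_demand[OF FX ij(1)]
    show "(D * G) $$ (i, j) = 0" if "FX $$ (i, j) = Sym0"
      using that d(2) ij by (subst DG) (auto simp: side_info_def)
    show "(D * G) $$ (i, j) = 1" if "FX $$ (i, j) = Sym1"
      using that d(3)[OF ij(2) that] ij by (subst DG) (auto simp: side_info_def)
  qed
  with D show ?thesis by blast
qed

section \<open>Optimal length and minimum rank\<close>

text \<open>Codes and fitting matrices are converted into each other without increasing length or
  rank. The given code \<open>G\<close> ensures that both \<open>LEAST\<close> operators range over
  nonempty sets.\<close>

lemma minrk_eq_optimal_length:
  fixes G :: "'q::{field,finite} mat"
  assumes FX: "fitting_matrix FX" and code: "index_code FX G"
  shows "minrk TYPE('q) FX = optimal_length TYPE('q) FX"
proof (rule antisym)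
  let ?P = "\<lambda>r. \<exists>G :: 'q mat. dim_row G = r \<and> index_code FX G"
  let ?Q = "\<lambda>s. \<exists>F :: 'q mat. F \<approx>\<^sub>X FX \<and> vec_space.rank (dim_row F) F = s"
  \<comment> \<open>The rank of \<open>D * H\<close> may be smaller than the length of the code,
    hence only some \<open>s\<close> \<le> \<open>r\<close>.\<close>
  have upper: "\<exists>s \<le> r. ?Q s" if Pr: "?P r" for r
  proof -
    obtain H :: "'q mat" where H: "dim_row H = r" "index_code FX H"
      using Pr by blast
    obtain D where D: "D \<in> carrier_mat (dim_row FX) r" "D * H \<approx>\<^sub>X FX"
      using decoding_matrix_if_index_code[OF FX H(2)] H(1) by blast
    have "vec_space.rank (dim_row FX) (D * H) \<le> r"
      by (rule vec_space.rank_mult_le_inner_dim[OF D(1)]) (use H in \<open>auto simp: index_code_def\<close>)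
    moreover have "dim_row (D * H) = dim_row FX" using D(1) by simp
    ultimately show ?thesis using D(2) by metis
  qed
  \<comment> \<open>In a rank factorization of \<open>F\<close> the right factor \<open>X\<close> is
    the code and the left factor \<open>B\<close> its decoding matrix.\<close>
  have lower: "?P s" if Qs: "?Q s" for s
  proof -
    obtain F :: "'q mat" where F: "F \<approx>\<^sub>X FX" "vec_space.rank (dim_row F) F = s"
      using Qs by blast
    then have dims: "F \<in> carrier_mat (dim_row FX) (dim_col FX)"
      by (simp add: fits_def)
    then obtain B X where "B \<in> carrier_mat (dim_row FX) s" "X \<in> carrier_mat s (dim_col FX)"
        "F = B * X"
      using vec_space.rank_factorization[OF dims] F(2) by auto
    then show ?thesis
      using index_code_if_decoding_matrix[OF FX, of B X] F(1) by auto
  qed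
  have P: "?P (dim_row G)" using code by blast
  then have "?P (optimal_length TYPE('q) FX)"
    unfolding optimal_length_def by (rule LeastI)
  from upper[OF this] obtain s where s: "s \<le> optimal_length TYPE('q) FX" "?Q s" by blast
  have "minrk TYPE('q) FX \<le> s"
    unfolding minrk_def by (rule Least_le[where P = ?Q, OF s(2)])
  with s(1) show "minrk TYPE('q) FX \<le> optimal_length TYPE('q) FX" by simp
  have "?Q (minrk TYPE('q) FX)"
    unfolding minrk_def by (rule LeastI[where P = ?Q, OF s(2)])
  from lower[OF this] show "optimal_length TYPE('q) FX \<le> minrk TYPE('q) FX"
    unfolding optimal_length_def by (rule Least_le)
qed

lemma optimal_length_eq_dim_row:
  fixes G :: "'q::{field,finite} mat"
  assumes "optimal_index_code FX G"
  shows "optimal_length TYPE('q) FX = dim_row G"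
  unfolding optimal_length_def
  using assms by (intro Least_equality) (auto simp: optimal_index_code_def)

section \<open>Block extensions\<close>

text \<open>Writing an index as block offset plus local index lets simplification evaluate the block
  entry directly.\<close>

lemma four_block_cases:
  fixes i j :: nat
  assumes "i < L1 + L2" "j < K1 + K2"
  obtains "i < L1" "j < K1" | j' where "i < L1" "j = K1 + j'" "j' < K2"
  | i' where "i = L1 + i'" "i' < L2" "j < K1"
  | i' j' where "i = L1 + i'" "i' < L2" "j = K1 + j'" "j' < K2"
proof -
  have "i < L1 \<or> (i - L1 < L2 \<and> i = L1 + (i - L1))"
    and "j < K1 \<or> (j - K1 < K2 \<and> j = K1 + (j - K1))"
    using assms by auto
  then show ?thesis using that by blast
qed

lemma fits_four_block_mat:
  assumes "F11 \<approx>\<^sub>X S11" "F12 \<approx>\<^sub>X S12" "F21 \<approx>\<^sub>X S21" "F22 \<approx>\<^sub>X S22"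
    and "S11 \<in> carrier_mat L1 K1" "S12 \<in> carrier_mat L1 K2"
    and "S21 \<in> carrier_mat L2 K1" "S22 \<in> carrier_mat L2 K2"
  shows "four_block_mat F11 F12 F21 F22 \<approx>\<^sub>X four_block_mat S11 S12 S21 S22"
  unfolding fits_def
proof (intro conjI allI impI)
  show "four_block_mat F11 F12 F21 F22
      \<in> carrier_mat (dim_row (four_block_mat S11 S12 S21 S22)) (dim_col (four_block_mat S11 S12 S21 S22))"
    using assms by (auto simp: fits_def)
  fix i j assume "i < dim_row (four_block_mat S11 S12 S21 S22)"
    "j < dim_col (four_block_mat S11 S12 S21 S22)"
  then have ij: "i < L1 + L2" "j < K1 + K2" using assms(5-8) by auto
  show "four_block_mat F11 F12 F21 F22 $$ (i, j) = 0"
    if "four_block_mat S11 S12 S21 S22 $$ (i, j) = Sym0"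
    using that assms by (cases rule: four_block_cases[OF ij]) (auto simp: fits_def)
  show "four_block_mat F11 F12 F21 F22 $$ (i, j) = 1"
    if "four_block_mat S11 S12 S21 S22 $$ (i, j) = Sym1"
    using that assms by (cases rule: four_block_cases[OF ij]) (auto simp: fits_def)
qed

text \<open>The off-diagonal blocks contain no \<open>Sym1\<close>, so each row has its 1 exactly
  where its diagonal block does, shifted by \<open>K\<close> in the lower rows. The two size
  inequalities add up.\<close>

lemma fitting_matrix_four_block_mat:
  assumes F: "F \<in> carrier_mat L K" "fitting_matrix F"
    and F': "F' \<in> carrier_mat L' K'" "fitting_matrix F'"
    and B: "B \<in> carrier_mat L K'" "X_fitting_matrix B"
    and B': "B' \<in> carrier_mat L' K" "X_fitting_matrix B'"
  shows "fitting_matrix (four_block_mat F B B' F')"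
proof -
  let ?E = "four_block_mat F B B' F'"
  have noB: "B $$ (i, j) \<noteq> Sym1" if "i < L" "j < K'" for i j
    using that B by (force simp: X_fitting_matrix_def)
  have noB': "B' $$ (i, j) \<noteq> Sym1" if "i < L'" "j < K" for i j
    using that B' by (force simp: X_fitting_matrix_def)
  have dims: "dim_row ?E = L + L'" "dim_col ?E = K + K'" using F F' by auto
  have dimF: "dim_row F = L" "dim_col F = K" "dim_row F' = L'" "dim_col F' = K'"
    using F F' by auto
  have E: "?E $$ (i, k) = (if i < L then if k < K then F $$ (i, k) else B $$ (i, k - K)
      else if k < K then B' $$ (i - L, k) else F' $$ (i - L, k - K))"
    if "i < L + L'" "k < K + K'" for i k
    using that dimF by simp
  have row: "\<exists>!k. k < K + K' \<and> ?E $$ (i, k) = Sym1" if i: "i < L + L'" for i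
  proof (cases "i < L")
    case True
    then have i': "i < dim_row F" using F by simp
    show ?thesis
    proof (rule ex1I[of _ "demand F i"])
      show "demand F i < K + K' \<and> ?E $$ (i, demand F i) = Sym1"
        using fitting_matrix_demand(1,2)[OF F(2) i'] dimF True i by (simp add: E)
      fix k assume "k < K + K' \<and> ?E $$ (i, k) = Sym1"
      then have k: "k < K + K'" "?E $$ (i, k) = Sym1" by auto
      then show "k = demand F i"
        using fitting_matrix_demand(3)[OF F(2) i', of k] noB[of i "k - K"] dimF True E[OF i k(1)]
        by (cases "k < K") simp_all
    qed
  next
    case False
    then have i': "i - L < dim_row F'" using i dimF by simp
    show ?thesis
    proof (rule ex1I[of _ "K + demand F' (i - L)"])
      show "K + demand F' (i - L) < K + K' \<and> ?E $$ (i, K + demand F' (i - L)) = Sym1"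
        using fitting_matrix_demand(1,2)[OF F'(2) i'] dimF False i by (simp add: E)
      fix k assume "k < K + K' \<and> ?E $$ (i, k) = Sym1"
      then have k: "k < K + K'" "?E $$ (i, k) = Sym1" by auto
      then show "k = K + demand F' (i - L)"
        using fitting_matrix_demand(3)[OF F'(2) i', of "k - K"] noB'[of "i - L" k]
          dimF False i E[OF i k(1)]
        by (cases "k < K") auto
    qed
  qed
  have col: "\<exists>i < L + L'. ?E $$ (i, k) = Sym1" if k: "k < K + K'" for k
  proof (cases "k < K")
    case True
    then obtain i where "i < L" "F $$ (i, k) = Sym1"
      using F(2) dimF by (auto simp: fitting_matrix_def)
    with True k show ?thesis by (intro exI[of _ i]) (simp add: E)
  next
    case False
    then have "k - K < K'" using k by simp
    then obtain i where "i < L'" "F' $$ (i, k - K) = Sym1"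
      using F'(2) dimF by (auto simp: fitting_matrix_def)
    with False k show ?thesis by (intro exI[of _ "L + i"]) (simp add: E)
  qed
  show ?thesis
    unfolding fitting_matrix_def dims
    using row col F(2) F'(2) dimF by (simp add: fitting_matrix_def)
qed

lemma submatrix_four_block_mat:
  assumes "A \<in> carrier_mat nr nc" "D \<in> carrier_mat nr' nc'"
  shows "submatrix (four_block_mat A B C D) {..<nr} {..<nc} = A"
proof -
  let ?E = "four_block_mat A B C D"
  \<comment> \<open>Entries of a submatrix are addressed by the number of smaller selected indices.
    For an initial segment that number is the index itself.\<close>
  have card_less: "card {a \<in> {..<m}. a < i} = i" if "i \<le> m" for i m :: nat
  proof -
    have "{a \<in> {..<m}. a < i} = {..<i}" using that by auto
    then show ?thesis by simp
  qed
  have "{i. i < dim_row ?E \<and> i \<in> {..<nr}} = {..<nr}"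
    "{j. j < dim_col ?E \<and> j \<in> {..<nc}} = {..<nc}"
    using assms by auto
  then have dims: "dim_row (submatrix ?E {..<nr} {..<nc}) = nr"
    "dim_col (submatrix ?E {..<nr} {..<nc}) = nc"
    by (simp_all only: dim_submatrix card_lessThan)
  show ?thesis
  proof (rule eq_matI)
    fix i j assume "i < dim_row A" "j < dim_col A"
    then have ij: "i < nr" "j < nc" using assms by auto
    then show "submatrix ?E {..<nr} {..<nc} $$ (i, j) = A $$ (i, j)"
      using submatrix_index_card[of i ?E j "{..<nr}" "{..<nc}"] card_less[of i nr] card_less[of j nc]
        assms by auto
  qed (use dims assms in auto)
qed

section \<open>Codes for the extended problem\<close>

text \<open>The upper left block of \<open>D * G\<close> involves only the top rows of
  \<open>D\<close> and the left columns of \<open>G\<close>, so the truncated \<open>D1\<close>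
  decodes the truncated \<open>H\<close>. Hence an extension never has a shorter code than
  \<open>FX\<close>.\<close>

lemma index_code_left_columns:
  fixes G :: "'q::{field,finite} mat"
  assumes "fitting_matrix FX" "fitting_matrix (four_block_mat FX B B' FX')"
    and code: "index_code (four_block_mat FX B B' FX') G"
  shows "\<exists>H :: 'q mat. dim_row H = dim_row G \<and> index_code FX H"
proof -
  let ?E = "four_block_mat FX B B' FX'"
  obtain D where D: "D \<in> carrier_mat (dim_row ?E) (dim_row G)" and fits: "D * G \<approx>\<^sub>X ?E"
    using decoding_matrix_if_index_code[OF assms(2) code] by blast
  have G: "dim_col G = dim_col ?E" using code by (simp add: index_code_def)
  define H where "H = mat (dim_row G) (dim_col FX) (\<lambda>(i, j). G $$ (i, j))"
  define D1 where "D1 = mat (dim_row FX) (dim_row G) (\<lambda>(i, j). D $$ (i, j))"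
  have eq: "(D1 * H) $$ (i, j) = (D * G) $$ (i, j)" if "i < dim_row FX" "j < dim_col FX" for i j
    using that D G by (auto simp: D1_def H_def scalar_prod_def)
  have "D1 * H \<approx>\<^sub>X FX"
    unfolding fits_def
  proof (intro conjI allI impI)
    show "D1 * H \<in> carrier_mat (dim_row FX) (dim_col FX)" by (intro carrier_matI) (simp_all add: D1_def H_def)
    fix i j assume ij: "i < dim_row FX" "j < dim_col FX"
    then have E: "?E $$ (i, j) = FX $$ (i, j)" "i < dim_row ?E" "j < dim_col ?E" by auto
    show "(D1 * H) $$ (i, j) = 0" if "FX $$ (i, j) = Sym0"
      using fits E that eq[OF ij] by (auto simp: fits_def)
    show "(D1 * H) $$ (i, j) = 1" if "FX $$ (i, j) = Sym1"
      using fits E that eq[OF ij] by (auto simp: fits_def)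
  qed
  moreover have "D1 \<in> carrier_mat (dim_row FX) (dim_row H)" by (simp add: D1_def H_def)
  ultimately have "index_code FX H"
    using index_code_if_decoding_matrix[OF assms(1)] by blast
  moreover have "dim_row H = dim_row G" by (simp add: H_def)
  ultimately show ?thesis by blast
qed

text \<open>Both concatenations are four-block matrices with empty blocks, so the inner dimension
  splits as \<open>r + 0\<close> and the products over the empty part are zero.\<close>

lemma append_rows_mult_append_cols:
  fixes A1 :: "'a::semiring_0 mat"
  assumes "A1 \<in> carrier_mat n1 r" "A2 \<in> carrier_mat n2 r"
    and "B1 \<in> carrier_mat r m1" "B2 \<in> carrier_mat r m2"
  shows "(A1 @\<^sub>r A2) * (B1 @\<^sub>c B2) = four_block_mat (A1 * B1) (A1 * B2) (A2 * B1) (A2 * B2)"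
proof -
  have "(A1 @\<^sub>r A2) * (B1 @\<^sub>c B2)
      = four_block_mat A1 (0\<^sub>m n1 0) A2 (0\<^sub>m n2 0) * four_block_mat B1 B2 (0\<^sub>m 0 m1) (0\<^sub>m 0 m2)"
    using assms by (simp add: append_rows_def append_cols_def)
  also have "\<dots> = four_block_mat (A1 * B1 + 0\<^sub>m n1 0 * 0\<^sub>m 0 m1) (A1 * B2 + 0\<^sub>m n1 0 * 0\<^sub>m 0 m2)
      (A2 * B1 + 0\<^sub>m n2 0 * 0\<^sub>m 0 m1) (A2 * B2 + 0\<^sub>m n2 0 * 0\<^sub>m 0 m2)"
    by (rule mult_four_block_mat[of _ n1 r _ 0 _ n2 _ _ m1 _ m2]) (use assms in auto)
  also have "\<dots> = four_block_mat (A1 * B1) (A1 * B2) (A2 * B1) (A2 * B2)"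
    using assms by (intro cong_four_block_mat) (auto intro!: eq_matI simp: scalar_prod_def)
  finally show ?thesis .
qed

lemma four_block_fits_involutory_code:
  fixes G :: "'q::{field,finite} mat"
  assumes G: "G \<in> carrier_mat r K" and D: "D \<in> carrier_mat L r" and C: "C \<in> carrier_mat r r"
    and inv: "involutory C"
    and FX: "FX \<in> carrier_mat L K" "D * G \<approx>\<^sub>X FX"
    and BX: "BX \<in> carrier_mat L K" "D * C * G \<approx>\<^sub>X BX"
  shows "(D @\<^sub>r (D * C)) * (G @\<^sub>c (C * G)) \<approx>\<^sub>X four_block_mat FX BX BX FX"
proof -
  have CG: "C * G \<in> carrier_mat r K" and DC: "D * C \<in> carrier_mat L r"
    using C G D by auto
  have DCG: "D * (C * G) = D * C * G"
    using assoc_mult_mat[OF D C G] by simp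
  \<comment> \<open>The involution enters here: the lower right block \<open>D * C * (C * G)\<close>
    collapses to \<open>D * G\<close>.\<close>
  have "C * (C * G) = (C * C) * G"
    using assoc_mult_mat[OF C C G] by simp
  also have "\<dots> = G"
    using inv C G by (simp add: involutory_def)
  finally have "D * C * (C * G) = D * G"
    using assoc_mult_mat[OF D C CG] by simp
  then show ?thesis
    using append_rows_mult_append_cols[OF D DC G CG]
      fits_four_block_mat[OF FX(2) BX(2) BX(2) FX(2) FX(1) BX(1) BX(1) FX(1)] DCG
    by simp
qed

text \<open>The existence of \<open>D\<close> is a separate conjunct because the second conjunct
  quantifies over every decoding matrix. Rank invariance appears both as equality of optimal lengths
  and as equality of \<open>minrk\<close>.\<close>

theorem theorem2:
  fixes FX :: "symbol mat" and G :: "'q::{field,finite} mat" and L K r :: nat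
  assumes "FX \<in> carrier_mat L K"
    and "fitting_matrix FX"
    and "G \<in> carrier_mat r K"
    and "index_code FX G"
  shows "(\<exists>D \<in> carrier_mat L r. D * G \<approx>\<^sub>X FX) \<and>
    (\<forall>D \<in> carrier_mat L r. \<forall>C \<in> carrier_mat r r. \<forall>BX \<in> carrier_mat L K.
       D * G \<approx>\<^sub>X FX \<longrightarrow> involutory C \<longrightarrow> X_fitting_matrix BX \<longrightarrow> D * C * G \<approx>\<^sub>X BX \<longrightarrow>
       (let FX_ext = four_block_mat FX BX BX FX in
          second_order_extension FX FX_ext \<and>
          index_code FX_ext (G @\<^sub>c (C * G)) \<and>
          (optimal_index_code FX G \<longrightarrow>
             optimal_index_code FX_ext (G @\<^sub>c (C * G)) \<and>
             rank_invariant_extension TYPE('q) FX FX_ext \<and>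
             minrk TYPE('q) FX_ext = minrk TYPE('q) FX)))"
proof (intro conjI ballI impI)
  show "\<exists>D \<in> carrier_mat L r. D * G \<approx>\<^sub>X FX"
    using decoding_matrix_if_index_code[OF assms(2,4)] assms(1,3) by auto
next
  fix D C :: "'q mat" and BX :: "symbol mat"
  assume D: "D \<in> carrier_mat L r" and C: "C \<in> carrier_mat r r" and BX: "BX \<in> carrier_mat L K"
    and DG: "D * G \<approx>\<^sub>X FX" and inv: "involutory C" and X: "X_fitting_matrix BX"
    and DCG: "D * C * G \<approx>\<^sub>X BX"
  define E where "E = four_block_mat FX BX BX FX"
  define H where "H = G @\<^sub>c (C * G)"
  have fit_E: "fitting_matrix E"
    unfolding E_def by (rule fitting_matrix_four_block_mat[OF assms(1,2) assms(1,2) BX X BX X])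
  have dim_H: "dim_row H = r" using assms(3) C by (simp add: H_def append_cols_def)
  have ext: "extension FX E"
    unfolding extension_def
    using fit_E assms(2) submatrix_four_block_mat[OF assms(1) assms(1), of BX BX]
    by (metis E_def)
  then have second: "second_order_extension FX E"
    unfolding second_order_extension_def using assms(1) by (auto simp: E_def)
  have code: "index_code E H"
  proof (rule index_code_if_decoding_matrix[OF fit_E])
    show "D @\<^sub>r (D * C) \<in> carrier_mat (dim_row E) (dim_row H)"
      using D C assms(1) dim_H by (auto simp: E_def append_rows_def)
    show "(D @\<^sub>r (D * C)) * H \<approx>\<^sub>X E"
      unfolding E_def H_def
      by (rule four_block_fits_involutory_code[OF assms(3) D C inv assms(1) DG BX DCG])
  qed
  have optimal: "optimal_index_code E H \<and> rank_invariant_extension TYPE('q) FX E \<and>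
      minrk TYPE('q) E = minrk TYPE('q) FX" if opt: "optimal_index_code FX G"
  proof -
    \<comment> \<open>A code \<open>G'\<close> for the extension yields a code of the same length
      for \<open>FX\<close>, which optimality of \<open>G\<close> makes at least \<open>r\<close>
      long.\<close>
    have "dim_row H \<le> dim_row G'" if "index_code E G'" for G' :: "'q mat"
      using index_code_left_columns[OF assms(2), of BX BX FX G'] fit_E that opt dim_H assms(3)
      by (auto simp: E_def optimal_index_code_def)
    with code have opt_H: "optimal_index_code E H"
      by (simp add: optimal_index_code_def)
    have "optimal_length TYPE('q) E = optimal_length TYPE('q) FX"
      using optimal_length_eq_dim_row[OF opt_H] optimal_length_eq_dim_row[OF opt] dim_H assms(3)
      by simp
    with opt_H ext show ?thesis
      using minrk_eq_optimal_length[OF fit_E code] minrk_eq_optimal_length[OF assms(2,4)]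
      by (simp add: rank_invariant_extension_def)
  qed
  show "let FX_ext = four_block_mat FX BX BX FX in
          second_order_extension FX FX_ext \<and>
          index_code FX_ext (G @\<^sub>c (C * G)) \<and>
          (optimal_index_code FX G \<longrightarrow>
             optimal_index_code FX_ext (G @\<^sub>c (C * G)) \<and>
             rank_invariant_extension TYPE('q) FX FX_ext \<and>
             minrk TYPE('q) FX_ext = minrk TYPE('q) FX)"
    using second code optimal unfolding E_def H_def Let_def by blast
qed

end
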